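(* Let $X$ be a discrete topological space of cardinality at least $\mathfrak c$. Then the free Abelian topological group $A(X)$ is discrete, and thus has a local $\omega^\omega$-base, while the smallest cardinality of a base of neighbourhoods of zero in the free locally convex space $L(X)$ is at least $\mathfrak c^+$, and so $L(X)$ does not have a local $\omega^\omega$-base.
   Context: $\mathfrak c$ is the cardinality of the continuum and $\mathfrak c^+$ its successor cardinal. The set $\omega^\omega$ of all functions $\omega\to\omega$ carries the pointwise partial order. A topological group (in particular the additive group of a topological vector space) has a local $\omega^\omega$-base if there is a family $\{U_\alpha:\alpha\in\omega^\omega\}$ of neighbourhoods of the identity such that $\alpha\le\beta$ implies $U_\beta\subseteq U_\alpha$ and every neighbourhood of the identity contains some $U_\alpha$. The free Abelian topological group $A(X)$ is the Abelian topological group containing $X$ as a topological subspace, algebraically generated by $X$, such that every continuous map from $X$ to an Abelian topological group extends to a continuous homomorphism on $A(X)$. The free (real) locally convex space $L(X)$ contains $X$ as a Hamel basis and every continuous map from $X$ to a locally convex space extends to a continuous linear map on $L(X)$. For discrete $X$, $L(X)$ is the direct sum of $|X|$ copies of $\mathbb R$ with the finest locally convex topology. *)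

theory Defs
  imports "HOL-Analysis.Analysis" "HOL-Algebra.Free_Abelian_Groups"
begin

unbundle cardinal_syntax

section \<open>Neighbourhoods, local bases and character\<close>

definition neighbourhoods :: "'b topology \<Rightarrow> 'b \<Rightarrow> 'b set set" where
  "neighbourhoods T x = {N. N \<subseteq> topspace T \<and> (\<exists>W. openin T W \<and> x \<in> W \<and> W \<subseteq> N)}"

definition local_base :: "'b topology \<Rightarrow> 'b \<Rightarrow> 'b set set \<Rightarrow> bool" where
  "local_base T x B \<longleftrightarrow>
     B \<subseteq> neighbourhoods T x \<and> (\<forall>N \<in> neighbourhoods T x. \<exists>U \<in> B. U \<subseteq> N)"

text \<open>The order on \<open>nat \<Rightarrow> nat\<close> is the pointwise one.\<close>

definition has_local_omega_omega_base :: "'b topology \<Rightarrow> 'b \<Rightarrow> bool" where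
  "has_local_omega_omega_base T x \<longleftrightarrow>
     (\<exists>U :: (nat \<Rightarrow> nat) \<Rightarrow> 'b set.
        (\<forall>\<alpha>. U \<alpha> \<in> neighbourhoods T x) \<and>
        (\<forall>\<alpha> \<beta>. \<alpha> \<le> \<beta> \<longrightarrow> U \<beta> \<subseteq> U \<alpha>) \<and>
        (\<forall>N \<in> neighbourhoods T x. \<exists>\<alpha>. U \<alpha> \<subseteq> N))"

text \<open>Cardinals are compared with the library's well-order-based cardinal arithmetic; the choice
  below is determined up to \<open>=o\<close>, see \<open>character_at\<close>.\<close>

definition character_at :: "'b topology \<Rightarrow> 'b \<Rightarrow> 'b set rel" where
  "character_at T x =
     |SOME B. local_base T x B \<and> (\<forall>B'. local_base T x B' \<longrightarrow> |B| \<le>o |B'| )|"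

lemma local_base_neighbourhoods: "local_base T x (neighbourhoods T x)"
  by (auto simp: local_base_def)

lemma character_at:
  obtains B where "local_base T x B" "character_at T x = |B|"
    "\<And>B'. local_base T x B' \<Longrightarrow> character_at T x \<le>o |B'|"
proof -
  let ?R = "{|B| |B. local_base T x B}"
  have "?R \<noteq> {}" "\<forall>r \<in> ?R. Card_order r"
    using local_base_neighbourhoods[of T x] by (auto intro: card_of_Card_order)
  then obtain r where "r \<in> ?R" "\<forall>r' \<in> ?R. r \<le>o r'"
    using exists_minim_Card_order[of ?R] by blast
  then have "\<exists>B. local_base T x B \<and> (\<forall>B'. local_base T x B' \<longrightarrow> |B| \<le>o |B'| )"
    by blast
  from someI_ex[OF this] show thesis
    by (intro that) (auto simp: character_at_def)
qed

abbreviation continuum :: "real rel" where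
  "continuum \<equiv> |UNIV :: real set|"

section \<open>Free Abelian topological groups\<close>

definition topological_abelian_group :: "'g monoid \<Rightarrow> 'g topology \<Rightarrow> bool" where
  "topological_abelian_group G T \<longleftrightarrow>
     comm_group G \<and> topspace T = carrier G \<and>
     continuous_map (prod_topology T T) T (\<lambda>(x, y). x \<otimes>\<^bsub>G\<^esub> y) \<and>
     continuous_map T T (\<lambda>x. inv\<^bsub>G\<^esub> x)"

text \<open>A definition cannot quantify over types, so the type \<open>'h\<close> that carries the groups to which
  maps extend is a parameter. No target is lost with \<open>'h = 'a \<Rightarrow>\<^sub>0 int\<close>, for \<open>X\<close> a space on \<open>'a\<close>:
  it is enough to extend into the subgroup generated by the image of \<open>X\<close>, a quotient of the free
  Abelian group on \<open>X\<close>, which therefore has an isomorphic copy with carrier in \<open>'a \<Rightarrow>\<^sub>0 int\<close>.\<close>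

definition free_abelian_topological_group ::
  "'h itself \<Rightarrow> 'a topology \<Rightarrow> 'g monoid \<Rightarrow> 'g topology \<Rightarrow> ('a \<Rightarrow> 'g) \<Rightarrow> bool" where
  "free_abelian_topological_group _ X G T \<iota> \<longleftrightarrow>
     topological_abelian_group G T \<and>
     embedding_map X T \<iota> \<and>
     generate G (\<iota> ` topspace X) = carrier G \<and>
     (\<forall>(H :: 'h monoid) S f.
        topological_abelian_group H S \<and> continuous_map X S f \<longrightarrow>
        (\<exists>g \<in> hom G H. continuous_map T S g \<and> (\<forall>x \<in> topspace X. g (\<iota> x) = f x)))"

section \<open>Free locally convex spaces\<close>

text \<open>A real topological vector space is given by its topology, whose \<^term>\<open>topspace\<close> is a linear
  subspace of an ambient type.\<close>

definition topological_vector_space :: "'v::real_vector topology \<Rightarrow> bool" where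
  "topological_vector_space T \<longleftrightarrow>
     subspace (topspace T) \<and>
     continuous_map (prod_topology T T) T (\<lambda>(x, y). x + y) \<and>
     continuous_map (prod_topology euclideanreal T) T (\<lambda>(c, x). c *\<^sub>R x)"

definition locally_convex_space :: "'v::real_vector topology \<Rightarrow> bool" where
  "locally_convex_space T \<longleftrightarrow>
     topological_vector_space T \<and> neighbourhood_base_at 0 convex T"

text \<open>The extension \<open>g\<close> is linear on the whole ambient type; this is no restriction, since every linear
  map on a subspace extends linearly. No target is lost with \<open>'w = 'v\<close>: it is enough to extend into
  the span of the image of \<open>X\<close>, whose dimension is at most that of \<^term>\<open>topspace T\<close>, so that it is
  linearly isomorphic to a subspace of \<open>'v\<close>.\<close>

definition free_locally_convex_space ::
  "'w::real_vector itself \<Rightarrow> 'a topology \<Rightarrow> 'v::real_vector topology \<Rightarrow> ('a \<Rightarrow> 'v) \<Rightarrow> bool" where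
  "free_locally_convex_space _ X T \<iota> \<longleftrightarrow>
     locally_convex_space T \<and>
     embedding_map X T \<iota> \<and>
     independent (\<iota> ` topspace X) \<and> span (\<iota> ` topspace X) = topspace T \<and>
     (\<forall>(S :: 'w topology) f.
        locally_convex_space S \<and> continuous_map X S f \<longrightarrow>
        (\<exists>g. linear g \<and> continuous_map T S g \<and> (\<forall>x \<in> topspace X. g (\<iota> x) = f x)))"

section \<open>Existence over discrete spaces\<close>

lemma embedding_map_discrete:
  assumes "inj_on f A" "f ` A \<subseteq> topspace T"
    and "\<And>x. x \<in> A \<Longrightarrow> \<exists>W. openin T W \<and> W \<inter> f ` A = {f x}"
  shows "embedding_map (discrete_topology A) T f"
proof -
  have "subtopology T (f ` A) = discrete_topology (f ` A)"
  proof -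
    have "topspace (subtopology T (f ` A)) = f ` A"
      using assms(2) by (simp add: Int_absorb1)
    moreover have "openin (subtopology T (f ` A)) {y}" if "y \<in> f ` A" for y
    proof -
      from that obtain x where x: "x \<in> A" "y = f x" by blast
      from assms(3)[OF x(1)] obtain W where "openin T W" "W \<inter> f ` A = {f x}" by blast
      then show ?thesis
        unfolding openin_subtopology x(2) by metis
    qed
    ultimately have "discrete_topology (f ` A) = subtopology T (f ` A)"
      unfolding discrete_topology_unique by blast
    then show ?thesis by (rule sym)
  qed
  moreover have "homeomorphic_map (discrete_topology A) (discrete_topology (f ` A)) f"
    unfolding homeomorphic_eq_everything_map using assms(1)
    by (simp add: open_map_def closed_map_def image_mono)
  ultimately show ?thesis
    by (simp add: embedding_map_def)
qed

lemma free_abelian_topological_group_exists: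
  "free_abelian_topological_group TYPE('h) (discrete_topology A) (free_Abelian_group A)
     (discrete_topology (carrier (free_Abelian_group A))) frag_of"
proof -
  let ?G = "free_Abelian_group A"
  interpret G: comm_group ?G
    by (rule abelian_free_Abelian_group)
  have gen: "x \<in> generate ?G (frag_of ` A)" if "Poly_Mapping.keys x \<subseteq> A" for x
    using that
  proof (rule free_Abelian_group_induct)
    show "0 \<in> generate ?G (frag_of ` A)" using generate.one[of ?G] by simp
  next
    fix x y
    assume 2: "Poly_Mapping.keys x \<subseteq> A" "Poly_Mapping.keys y \<subseteq> A"
      "x \<in> generate ?G (frag_of ` A)" "y \<in> generate ?G (frag_of ` A)"
    have "inv\<^bsub>?G\<^esub> y \<in> generate ?G (frag_of ` A)"
      using 2 by (intro G.generate_m_inv_closed) (simp_all add: image_subset_iff)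
    with 2 have "x \<otimes>\<^bsub>?G\<^esub> inv\<^bsub>?G\<^esub> y \<in> generate ?G (frag_of ` A)"
      by (blast intro: generate.eng)
    with 2 show "x - y \<in> generate ?G (frag_of ` A)" by simp
  next
    show "frag_of a \<in> generate ?G (frag_of ` A)" if "a \<in> A" for a
      using that by (blast intro: generate.incl)
  qed
  have ext: "\<exists>g \<in> hom ?G H. continuous_map (discrete_topology (carrier ?G)) S g \<and>
      (\<forall>x \<in> A. g (frag_of x) = f x)"
    if "topological_abelian_group H S" "continuous_map (discrete_topology A) S f"
    for H :: "'h monoid" and S f
  proof -
    interpret H: comm_group H
      using that by (simp add: topological_abelian_group_def)
    have top: "topspace S = carrier H"
      using that by (simp add: topological_abelian_group_def)
    have "f ` A \<subseteq> carrier H"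
      using that top by auto
    then obtain g where "g \<in> hom ?G H" "\<And>x. x \<in> A \<Longrightarrow> g (frag_of x) = f x"
      using H.free_Abelian_group_universal[of f A] by metis
    then show ?thesis
      using top unfolding hom_def continuous_map_from_discrete_topology by blast
  qed
  have "generate ?G (frag_of ` A) = carrier ?G"
  proof
    show "generate ?G (frag_of ` A) \<subseteq> carrier ?G"
      by (intro G.generate_incl) auto
    show "carrier ?G \<subseteq> generate ?G (frag_of ` A)"
      using gen by (meson carrier_free_Abelian_group_iff subsetI)
  qed
  moreover have "embedding_map (discrete_topology A) (discrete_topology (carrier ?G)) frag_of"
  proof (rule embedding_map_discrete)
    show "inj_on frag_of A"
      by (metis frag_of_eq inj_onI)
    show sub: "frag_of ` A \<subseteq> topspace (discrete_topology (carrier ?G))"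
      by (simp add: image_subset_iff)
    show "\<exists>W. openin (discrete_topology (carrier ?G)) W \<and> W \<inter> frag_of ` A = {frag_of x}"
      if "x \<in> A" for x
      using that sub by (intro exI[of _ "{frag_of x}"]) (simp add: image_subset_iff)
  qed
  moreover have "topological_abelian_group ?G (discrete_topology (carrier ?G))"
    unfolding topological_abelian_group_def prod_topology_discrete_topology[symmetric]
    using G.comm_group_axioms G.m_closed G.inv_closed
    by (simp del: carrier_free_Abelian_group_iff mult_free_Abelian_group inv_free_Abelian_group
        add: Pi_iff)
  ultimately show ?thesis
    using ext by (simp add: free_abelian_topological_group_def)
qed

text \<open>The finest locally convex topology on the span of an independent set \<open>B\<close> is generated by the
  weighted \<open>\<ell>\<^sub>1\<close>-norms in the coordinates with respect to \<open>B\<close>.\<close>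

definition wnorm :: "'v::real_vector set \<Rightarrow> ('v \<Rightarrow> real) \<Rightarrow> 'v \<Rightarrow> real" where
  "wnorm B w x = (\<Sum>b | representation B x b \<noteq> 0. w b * \<bar>representation B x b\<bar>)"

definition direct_sum_topology :: "'v::real_vector set \<Rightarrow> 'v topology" where
  "direct_sum_topology B = topology (\<lambda>U. U \<subseteq> span B \<and>
     (\<forall>x \<in> U. \<exists>w. (\<forall>b. 0 < w b) \<and> (\<forall>y \<in> span B. wnorm B w (y - x) < 1 \<longrightarrow> y \<in> U)))"

context
  fixes B :: "'v::real_vector set"
  assumes indep: "independent B"
begin

lemma wnorm_superset:
  assumes "finite F" "{b. representation B x b \<noteq> 0} \<subseteq> F"
  shows "wnorm B w x = (\<Sum>b\<in>F. w b * \<bar>representation B x b\<bar>)"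
  unfolding wnorm_def using assms by (intro sum.mono_neutral_left) auto

lemma wnorm_mono:
  assumes "\<And>b. w b \<le> w' b"
  shows "wnorm B w x \<le> wnorm B w' x"
  unfolding wnorm_def by (intro sum_mono mult_right_mono assms) auto

lemma wnorm_zero [simp]: "wnorm B w 0 = 0"
  using indep by (simp add: wnorm_def representation_zero)

lemma wnorm_nonneg: "(\<And>b. 0 < w b) \<Longrightarrow> 0 \<le> wnorm B w x"
  unfolding wnorm_def by (intro sum_nonneg mult_nonneg_nonneg) (auto intro: less_imp_le)

lemma wnorm_scale:
  assumes "x \<in> span B"
  shows "wnorm B w (c *\<^sub>R x) = \<bar>c\<bar> * wnorm B w x"
proof -
  let ?F = "{b. representation B x b \<noteq> 0}"
  have fin: "finite ?F" by (rule finite_representation)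
  have "wnorm B w (c *\<^sub>R x) = (\<Sum>b\<in>?F. w b * \<bar>representation B (c *\<^sub>R x) b\<bar>)"
    by (rule wnorm_superset[OF fin]) (auto simp: representation_scale[OF indep assms])
  also have "\<dots> = \<bar>c\<bar> * wnorm B w x"
    by (simp add: wnorm_def representation_scale[OF indep assms] sum_distrib_left abs_mult
        algebra_simps)
  finally show ?thesis .
qed

lemma wnorm_scale_weight: "wnorm B (\<lambda>b. c * w b) x = c * wnorm B w x"
  by (simp add: wnorm_def sum_distrib_left mult.assoc)

lemma wnorm_triangle:
  assumes "x \<in> span B" "y \<in> span B" "\<And>b. 0 < w b"
  shows "wnorm B w (x + y) \<le> wnorm B w x + wnorm B w y"
proof -
  let ?F = "{b. representation B x b \<noteq> 0} \<union> {b. representation B y b \<noteq> 0}"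
  have fin: "finite ?F" by (simp add: finite_representation)
  have "wnorm B w (x + y) = (\<Sum>b\<in>?F. w b * \<bar>representation B (x + y) b\<bar>)"
    by (rule wnorm_superset[OF fin]) (auto simp: representation_add[OF indep assms(2,1)])
  also have "\<dots> \<le> (\<Sum>b\<in>?F. w b * \<bar>representation B x b\<bar> + w b * \<bar>representation B y b\<bar>)"
    using assms(3) by (intro sum_mono)
      (auto simp: representation_add[OF indep assms(2,1)] simp flip: distrib_left intro: less_imp_le)
  also have "\<dots> = wnorm B w x + wnorm B w y"
    by (simp add: sum.distrib wnorm_superset[OF fin])
  finally show ?thesis .
qed

lemma openin_direct_sum_topology:
  "openin (direct_sum_topology B) U \<longleftrightarrow> U \<subseteq> span B \<and>
     (\<forall>x \<in> U. \<exists>w. (\<forall>b. 0 < w b) \<and> (\<forall>y \<in> span B. wnorm B w (y - x) < 1 \<longrightarrow> y \<in> U))"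
proof -
  let ?P = "\<lambda>U. U \<subseteq> span B \<and>
     (\<forall>x \<in> U. \<exists>w. (\<forall>b. 0 < w b) \<and> (\<forall>y \<in> span B. wnorm B w (y - x) < 1 \<longrightarrow> y \<in> U))"
  have int: "?P (U \<inter> V)" if U: "?P U" and V: "?P V" for U V
  proof (intro conjI ballI)
    show "U \<inter> V \<subseteq> span B" using U by blast
    fix x assume "x \<in> U \<inter> V"
    then obtain w w' where w: "\<forall>b. 0 < w b" "\<forall>y \<in> span B. wnorm B w (y - x) < 1 \<longrightarrow> y \<in> U"
      and w': "\<forall>b. 0 < w' b" "\<forall>y \<in> span B. wnorm B w' (y - x) < 1 \<longrightarrow> y \<in> V"
      using U V by blast
    let ?m = "\<lambda>b. max (w b) (w' b)"
    have "wnorm B w y \<le> wnorm B ?m y" "wnorm B w' y \<le> wnorm B ?m y" for y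
      by (auto intro!: wnorm_mono)
    then have "\<forall>y \<in> span B. wnorm B ?m (y - x) < 1 \<longrightarrow> y \<in> U \<inter> V"
      using w(2) w'(2) by (meson IntI le_less_trans)
    moreover have "\<forall>b. 0 < ?m b"
      using w(1) by (simp add: less_max_iff_disj)
    ultimately show "\<exists>w. (\<forall>b. 0 < w b) \<and>
        (\<forall>y \<in> span B. wnorm B w (y - x) < 1 \<longrightarrow> y \<in> U \<inter> V)"
      by (intro exI[of _ ?m] conjI)
  qed
  have un: "?P (\<Union>K)" if "\<forall>U \<in> K. ?P U" for K
  proof (intro conjI ballI)
    show "\<Union>K \<subseteq> span B" using that by blast
    fix x assume "x \<in> \<Union>K"
    then obtain U where "U \<in> K" "x \<in> U" by blast
    then show "\<exists>w. (\<forall>b. 0 < w b) \<and> (\<forall>y \<in> span B. wnorm B w (y - x) < 1 \<longrightarrow> y \<in> \<Union>K)"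
      using that by (meson UnionI)
  qed
  have "istopology ?P"
    unfolding istopology_def using int un by blast
  then show ?thesis
    unfolding direct_sum_topology_def by simp
qed

lemma topspace_direct_sum_topology [simp]: "topspace (direct_sum_topology B) = span B"
proof -
  have "openin (direct_sum_topology B) (span B)"
    by (auto simp: openin_direct_sum_topology intro!: exI[of _ "\<lambda>_. 1"])
  moreover have "topspace (direct_sum_topology B) \<subseteq> span B"
    using openin_topspace[of "direct_sum_topology B"] openin_direct_sum_topology by blast
  ultimately show ?thesis
    by (meson openin_subset subset_antisym)
qed

definition wball :: "('v \<Rightarrow> real) \<Rightarrow> 'v \<Rightarrow> 'v set" where
  "wball w x = {y \<in> span B. wnorm B w (y - x) < 1}"

lemma openin_wball:
  assumes "\<And>b. 0 < w b" "x \<in> span B"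
  shows "openin (direct_sum_topology B) (wball w x)"
  unfolding openin_direct_sum_topology
proof (intro conjI ballI)
  show "wball w x \<subseteq> span B" by (auto simp: wball_def)
  fix y assume "y \<in> wball w x"
  then have y: "y \<in> span B" "wnorm B w (y - x) < 1" by (auto simp: wball_def)
  define r where "r = 1 - wnorm B w (y - x)"
  have r: "r > 0" using y by (simp add: r_def)
  let ?w = "\<lambda>b. inverse r * w b"
  have "z \<in> wball w x" if z: "z \<in> span B" "wnorm B ?w (z - y) < 1" for z
  proof -
    have "wnorm B w (z - y) < r"
      using z(2) r unfolding wnorm_scale_weight by (simp add: field_simps)
    moreover have "wnorm B w (z - x) \<le> wnorm B w (z - y) + wnorm B w (y - x)"
      using wnorm_triangle[of "z - y" "y - x" w] z y assms by (simp add: span_diff)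
    ultimately show ?thesis
      using z by (simp add: wball_def r_def)
  qed
  then show "\<exists>w'. (\<forall>b. 0 < w' b) \<and>
      (\<forall>z \<in> span B. wnorm B w' (z - y) < 1 \<longrightarrow> z \<in> wball w x)"
    using assms(1) r by (intro exI[of _ ?w]) auto
qed

lemma centre_in_wball: "x \<in> span B \<Longrightarrow> x \<in> wball w x"
  by (simp add: wball_def)

lemma openin_direct_sum_topology_wball:
  "openin (direct_sum_topology B) U \<longleftrightarrow>
     U \<subseteq> span B \<and> (\<forall>x \<in> U. \<exists>w. (\<forall>b. 0 < w b) \<and> wball w x \<subseteq> U)"
  unfolding openin_direct_sum_topology wball_def by blast

lemma convex_wball:
  assumes "\<And>b. 0 < w b"
  shows "convex (wball w 0)"
proof (rule convexI)
  fix x y and u v :: real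
  assume xy: "x \<in> wball w 0" "y \<in> wball w 0" and uv: "0 \<le> u" "0 \<le> v" "u + v = 1"
  have s: "x \<in> span B" "y \<in> span B" using xy by (auto simp: wball_def)
  have "wnorm B w (u *\<^sub>R x + v *\<^sub>R y) \<le> u * wnorm B w x + v * wnorm B w y"
    using wnorm_triangle[of "u *\<^sub>R x" "v *\<^sub>R y" w] assms s uv
    by (simp add: span_scale wnorm_scale)
  also have "\<dots> < 1"
    using xy uv by (intro convex_bound_lt) (auto simp: wball_def)
  finally show "u *\<^sub>R x + v *\<^sub>R y \<in> wball w 0"
    using s by (simp add: wball_def span_add span_scale)
qed

lemma locally_convex_direct_sum_topology: "locally_convex_space (direct_sum_topology B)"
proof -
  let ?T = "direct_sum_topology B"
  have add: "continuous_map (prod_topology ?T ?T) ?T (\<lambda>(x, y). x + y)"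
  proof (subst continuous_map_def, intro conjI allI impI)
    show "(\<lambda>(x, y). x + y) \<in> topspace (prod_topology ?T ?T) \<rightarrow> topspace ?T"
      by (auto simp: span_add)
    fix U assume U: "openin ?T U"
    show "openin (prod_topology ?T ?T)
        {p \<in> topspace (prod_topology ?T ?T). (case p of (x, y) \<Rightarrow> x + y) \<in> U}"
      unfolding openin_prod_topology_alt
    proof (intro allI impI)
      fix x y
      assume "(x, y) \<in> {p \<in> topspace (prod_topology ?T ?T). (case p of (x, y) \<Rightarrow> x + y) \<in> U}"
      then have xy: "x \<in> span B" "y \<in> span B" "x + y \<in> U" by auto
      then obtain w where w: "\<And>b. 0 < w b" "wball w (x + y) \<subseteq> U"
        using U openin_direct_sum_topology_wball by blast
      let ?w = "\<lambda>b. 2 * w b"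
      have "x' + y' \<in> U" if "x' \<in> wball ?w x" "y' \<in> wball ?w y" for x' y'
      proof -
        have s: "x' \<in> span B" "y' \<in> span B"
          and "2 * wnorm B w (x' - x) < 1" "2 * wnorm B w (y' - y) < 1"
          using that by (auto simp: wball_def wnorm_scale_weight)
        moreover have "wnorm B w ((x' - x) + (y' - y)) \<le> wnorm B w (x' - x) + wnorm B w (y' - y)"
          using s xy w by (intro wnorm_triangle) (auto simp: span_diff)
        moreover have "(x' - x) + (y' - y) = (x' + y') - (x + y)" by simp
        ultimately have "wnorm B w ((x' + y') - (x + y)) < 1" by simp
        then show ?thesis
          using w(2) s by (auto simp: wball_def span_add)
      qed
      moreover have "wball ?w x \<subseteq> span B" "wball ?w y \<subseteq> span B" by (auto simp: wball_def)
      ultimately show "\<exists>V W. openin ?T V \<and> openin ?T W \<and> x \<in> V \<and> y \<in> W \<and> V \<times> W \<subseteq>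
          {p \<in> topspace (prod_topology ?T ?T). (case p of (x, y) \<Rightarrow> x + y) \<in> U}"
        using xy w(1) by (intro exI[of _ "wball ?w x"] exI[of _ "wball ?w y"])
          (auto simp: openin_wball centre_in_wball)
    qed
  qed
  have scale: "continuous_map (prod_topology euclideanreal ?T) ?T (\<lambda>(c, x). c *\<^sub>R x)"
  proof (subst continuous_map_def, intro conjI allI impI)
    show "(\<lambda>(c, x). c *\<^sub>R x) \<in> topspace (prod_topology euclideanreal ?T) \<rightarrow> topspace ?T"
      by (auto simp: span_scale)
    fix U assume U: "openin ?T U"
    show "openin (prod_topology euclideanreal ?T)
        {p \<in> topspace (prod_topology euclideanreal ?T). (case p of (c, x) \<Rightarrow> c *\<^sub>R x) \<in> U}"
      unfolding openin_prod_topology_alt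
    proof (intro allI impI)
      fix c :: real and x
      assume "(c, x) \<in> {p \<in> topspace (prod_topology euclideanreal ?T).
          (case p of (c, x) \<Rightarrow> c *\<^sub>R x) \<in> U}"
      then have cx: "x \<in> span B" "c *\<^sub>R x \<in> U" by auto
      then obtain w where w: "\<And>b. 0 < w b" "wball w (c *\<^sub>R x) \<subseteq> U"
        using U openin_direct_sum_topology_wball by blast
      define e where "e = min 1 (1 / (2 * (wnorm B w x + 1)))"
      have nn: "0 \<le> wnorm B w y" for y using w(1) by (rule wnorm_nonneg)
      have e: "e > 0" "e \<le> 1" "e * wnorm B w x < 1 / 2"
      proof -
        show "e > 0" "e \<le> 1" using nn[of x] by (auto simp: e_def)
        have "e * (wnorm B w x + 1) \<le> 1 / 2"
          using nn[of x] by (auto simp: e_def min_def field_simps)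
        with \<open>e > 0\<close> show "e * wnorm B w x < 1 / 2" by (simp add: algebra_simps)
      qed
      let ?k = "2 * (\<bar>c\<bar> + 1)"
      let ?w = "\<lambda>b. ?k * w b"
      have in_U: "c' *\<^sub>R x' \<in> U" if c': "c' \<in> ball c e" and x': "x' \<in> wball ?w x" for c' x'
      proof -
        have s: "x' \<in> span B" and b: "?k * wnorm B w (x' - x) < 1"
          using x' by (auto simp: wball_def wnorm_scale_weight)
        have d: "\<bar>c' - c\<bar> < e" using c' by (simp add: dist_real_def)
        have "c' *\<^sub>R x' - c *\<^sub>R x = (c' - c) *\<^sub>R x + c' *\<^sub>R (x' - x)"
          by (simp add: algebra_simps)
        then have "wnorm B w (c' *\<^sub>R x' - c *\<^sub>R x) \<le>
            wnorm B w ((c' - c) *\<^sub>R x) + wnorm B w (c' *\<^sub>R (x' - x))"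
          using s cx w by (metis wnorm_triangle span_scale span_diff)
        also have "\<dots> = \<bar>c' - c\<bar> * wnorm B w x + \<bar>c'\<bar> * wnorm B w (x' - x)"
          using s cx by (simp add: wnorm_scale span_diff)
        also have "\<dots> \<le> e * wnorm B w x + (\<bar>c\<bar> + 1) * wnorm B w (x' - x)"
          using d e nn by (intro add_mono mult_right_mono) auto
        also have "\<dots> < 1"
        proof -
          have "2 * ((\<bar>c\<bar> + 1) * wnorm B w (x' - x)) < 1"
            using b by (simp only: mult.assoc)
          with e(3) show ?thesis by linarith
        qed
        finally show ?thesis
          using w(2) s by (auto simp: wball_def span_scale)
      qed
      have "wball ?w x \<subseteq> span B" by (auto simp: wball_def)
      moreover have "\<And>b. 0 < ?w b" using w(1) by (simp add: add_nonneg_pos)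
      ultimately show "\<exists>V W. openin euclideanreal V \<and> openin ?T W \<and> c \<in> V \<and> x \<in> W \<and> V \<times> W \<subseteq>
          {p \<in> topspace (prod_topology euclideanreal ?T). (case p of (c, x) \<Rightarrow> c *\<^sub>R x) \<in> U}"
        using cx e in_U openin_wball[of ?w x] centre_in_wball[of x ?w]
        by (intro exI[of _ "ball c e"] exI[of _ "wball ?w x"]) auto
    qed
  qed
  have "neighbourhood_base_at 0 convex ?T"
    unfolding neighbourhood_base_at_def
  proof (intro allI impI)
    fix W assume "openin ?T W \<and> 0 \<in> W"
    then obtain w where w: "\<And>b. 0 < w b" "wball w 0 \<subseteq> W"
      using openin_direct_sum_topology_wball by blast
    then show "\<exists>U V. openin ?T U \<and> convex V \<and> 0 \<in> U \<and> U \<subseteq> V \<and> V \<subseteq> W"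
      by (intro exI[of _ "wball w 0"]) (auto simp: openin_wball convex_wball centre_in_wball span_zero)
  qed
  with add scale show ?thesis
    by (simp add: locally_convex_space_def topological_vector_space_def)
qed

lemma linear_continuous_direct_sum_topology:
  fixes S :: "'w::real_vector topology"
  assumes S: "locally_convex_space S" and g: "linear g" "g ` B \<subseteq> topspace S"
  shows "continuous_map (direct_sum_topology B) S g"
proof -
  have sub: "subspace (topspace S)"
    and cadd: "continuous_map (prod_topology S S) S (\<lambda>(x, y). x + y)"
    and cscale: "continuous_map (prod_topology euclideanreal S) S (\<lambda>(c, x). c *\<^sub>R x)"
    and base: "neighbourhood_base_at 0 convex S"
    using S by (auto simp: locally_convex_space_def topological_vector_space_def)
  have gspan: "g x \<in> topspace S" if "x \<in> span B" for x
  proof -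
    have "g x \<in> span (g ` B)" using that g(1) by (simp add: linear_span_image)
    then show ?thesis using span_minimal[OF g(2) sub] by blast
  qed
  show ?thesis
  proof (subst continuous_map_def, intro conjI allI impI)
    show "g \<in> topspace (direct_sum_topology B) \<rightarrow> topspace S"
      using gspan by auto
    fix U assume U: "openin S U"
    show "openin (direct_sum_topology B) {x \<in> topspace (direct_sum_topology B). g x \<in> U}"
      unfolding openin_direct_sum_topology_wball
    proof (intro conjI ballI)
      fix x assume "x \<in> {x \<in> topspace (direct_sum_topology B). g x \<in> U}"
      then have x: "x \<in> span B" "g x \<in> U" by auto
      have "continuous_map S S (\<lambda>y. g x + y)"
        using continuous_map_compose[of S "prod_topology S S" "\<lambda>y. (g x, y)" S "\<lambda>(x, y). x + y"]
          cadd gspan[OF x(1)] by (simp add: o_def continuous_map_pairedI)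
      then have "openin S {y \<in> topspace S. g x + y \<in> U}"
        using U by (rule openin_continuous_map_preimage)
      moreover have "0 \<in> {y \<in> topspace S. g x + y \<in> U}"
        using x sub by (simp add: subspace_0)
      ultimately obtain W C where W: "openin S W" "0 \<in> W" "W \<subseteq> C" and C: "convex C"
        "C \<subseteq> {y \<in> topspace S. g x + y \<in> U}"
        using base unfolding neighbourhood_base_at_def by meson
      have "\<exists>e>0. \<forall>c. \<bar>c\<bar> \<le> e \<longrightarrow> c *\<^sub>R g b \<in> W" if "b \<in> B" for b
      proof -
        have "continuous_map euclideanreal S (\<lambda>c. c *\<^sub>R g b)"
          using continuous_map_compose[of euclideanreal "prod_topology euclideanreal S"
              "\<lambda>c. (c, g b)" S "\<lambda>(c, x). c *\<^sub>R x"] cscale gspan[of b] that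
          by (simp add: o_def continuous_map_pairedI span_base)
        then have "openin euclideanreal {c \<in> topspace euclideanreal. c *\<^sub>R g b \<in> W}"
          using W(1) by (rule openin_continuous_map_preimage)
        then have "open {c. c *\<^sub>R g b \<in> W}" by simp
        moreover have "0 \<in> {c. c *\<^sub>R g b \<in> W}" using W(2) by simp
        ultimately obtain e where "e > 0" "cball 0 e \<subseteq> {c. c *\<^sub>R g b \<in> W}"
          by (meson open_contains_cball)
        then show ?thesis by (intro exI[of _ e]) (auto simp: subset_iff)
      qed
      then obtain e where e: "\<And>b. b \<in> B \<Longrightarrow> e b > 0"
        "\<And>b c. b \<in> B \<Longrightarrow> \<bar>c\<bar> \<le> e b \<Longrightarrow> c *\<^sub>R g b \<in> W"
        by metis
      define w where "w = (\<lambda>b. if b \<in> B then inverse (e b) else 1)"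
      have w: "0 < w b" for b using e by (simp add: w_def)
      have "g y \<in> U" if y: "y \<in> wball w x" for y
      proof -
        define d where "d = y - x"
        have ds: "d \<in> span B" and dn: "wnorm B w d < 1" and ys: "y \<in> span B"
          using y x by (auto simp: wball_def d_def span_diff)
        let ?F = "{b. representation B d b \<noteq> 0}"
        let ?r = "representation B d"
        have fin: "finite ?F" by (rule finite_representation)
        have FB: "b \<in> B" if "b \<in> ?F" for b using that representation_ne_zero by blast
        have "d = (\<Sum>b\<in>?F. ?r b *\<^sub>R b)"
          using sum_nonzero_representation_eq[OF indep ds] by simp
        then have "g d = (\<Sum>b\<in>?F. ?r b *\<^sub>R g b)"
          by (metis (no_types, lifting) linear_sum[OF g(1)] linear_scale[OF g(1)] sum.cong)
        also have "\<dots> = (\<Sum>b\<in>?F. (w b * \<bar>?r b\<bar>) *\<^sub>R ((sgn (?r b) * e b) *\<^sub>R g b))"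
        proof (rule sum.cong)
          fix b assume "b \<in> ?F"
          then have "e b \<noteq> 0" "b \<in> B" using FB e(1)[of b] by auto
          then have "?r b = w b * \<bar>?r b\<bar> * (sgn (?r b) * e b)"
            by (simp add: w_def sgn_if)
          then show "?r b *\<^sub>R g b = (w b * \<bar>?r b\<bar>) *\<^sub>R ((sgn (?r b) * e b) *\<^sub>R g b)"
            by (metis scaleR_scaleR)
        qed simp
        also have "\<dots> \<in> C"
        proof -
          let ?a = "\<lambda>b. w b * \<bar>?r b\<bar>"
          let ?q = "\<lambda>b. (sgn (?r b) * e b) *\<^sub>R g b"
          have q: "?q b \<in> C" if "b \<in> ?F" for b
            using that W(3) e(1)[of b] FB[of b]
            by (intro subsetD[OF W(3)] e(2)) (auto simp: abs_mult abs_sgn_eq)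
          have "0 \<notin> ?F" using FB indep dependent_zero by blast
          have "(\<Sum>b\<in>insert 0 ?F. (if b = 0 then 1 - wnorm B w d else ?a b) *\<^sub>R
              (if b = 0 then 0 else ?q b)) \<in> C"
          proof (rule convex_sum[OF _ C(1)])
            show "finite (insert 0 ?F)" using fin by simp
            show "(\<Sum>b\<in>insert 0 ?F. if b = 0 then 1 - wnorm B w d else ?a b) = 1"
            proof -
              have "(\<Sum>b\<in>?F. if b = 0 then 1 - wnorm B w d else ?a b) = wnorm B w d"
                unfolding wnorm_def using \<open>0 \<notin> ?F\<close> by (intro sum.cong) auto
              then show ?thesis using fin \<open>0 \<notin> ?F\<close> by (subst sum.insert) auto
            qed
            show "0 \<le> (if b = 0 then 1 - wnorm B w d else ?a b)" for b
              using dn w[of b] by simp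
            show "(if b = 0 then 0 else ?q b) \<in> C" if "b \<in> insert 0 ?F" for b
              using that q[of b] W by auto
          qed
          also have "(\<Sum>b\<in>insert 0 ?F. (if b = 0 then 1 - wnorm B w d else ?a b) *\<^sub>R
              (if b = 0 then 0 else ?q b)) = (\<Sum>b\<in>?F. ?a b *\<^sub>R ?q b)"
            using fin \<open>0 \<notin> ?F\<close> by (subst sum.insert) (auto intro!: sum.cong)
          finally show ?thesis .
        qed
        finally have "g x + g d \<in> U" using C(2) by blast
        moreover have "g y = g x + g d"
          using g(1) by (simp add: d_def linear_diff)
        ultimately show "g y \<in> U" by simp
      qed
      then show "\<exists>w. (\<forall>b. 0 < w b) \<and>
          wball w x \<subseteq> {x \<in> topspace (direct_sum_topology B). g x \<in> U}"
        using w by (intro exI[of _ w]) (auto simp: wball_def)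
    qed auto
  qed
qed

lemma basis_discrete_direct_sum_topology:
  assumes "b \<in> B"
  shows "\<exists>W. openin (direct_sum_topology B) W \<and> W \<inter> B = {b}"
proof (intro exI conjI)
  let ?W = "wball (\<lambda>_. 1) b"
  show "openin (direct_sum_topology B) ?W"
    using assms by (intro openin_wball) (auto simp: span_base)
  have "c \<notin> ?W" if c: "c \<in> B" "c \<noteq> b" for c
  proof -
    have rep: "representation B (c - b) z = (if z = c then 1 else 0) - (if z = b then 1 else 0)" for z
      using assms c by (simp add: representation_diff[OF indep] span_base
          representation_basis[OF indep])
    have "wnorm B (\<lambda>_. 1) (c - b) = (\<Sum>z\<in>{b, c}. \<bar>representation B (c - b) z\<bar>)"
      by (subst wnorm_superset[of "{b, c}"]) (auto simp: rep split: if_splits)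
    then have "wnorm B (\<lambda>_. 1) (c - b) = 2"
      using c(2) by (simp add: rep)
    then show ?thesis by (simp add: wball_def)
  qed
  then show "?W \<inter> B = {b}"
    using assms centre_in_wball[of b] by (auto simp: span_base)
qed

end

lemma free_locally_convex_space_exists:
  fixes \<iota> :: "'a \<Rightarrow> 'v::real_vector"
  assumes inj: "inj_on \<iota> A" and indep: "independent (\<iota> ` A)"
  shows "free_locally_convex_space TYPE('w::real_vector) (discrete_topology A)
    (direct_sum_topology (\<iota> ` A)) \<iota>"
proof -
  let ?T = "direct_sum_topology (\<iota> ` A)"
  have "embedding_map (discrete_topology A) ?T \<iota>"
    using inj indep basis_discrete_direct_sum_topology[OF indep]
    by (intro embedding_map_discrete) (auto simp: span_base)
  moreover have "\<exists>g. linear g \<and> continuous_map ?T S g \<and> (\<forall>x \<in> A. g (\<iota> x) = f x)"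
    if S: "locally_convex_space S" "continuous_map (discrete_topology A) S f"
    for S :: "'w topology" and f
  proof -
    obtain g where g: "linear g" "\<forall>b \<in> \<iota> ` A. g b = f (inv_into A \<iota> b)"
      using linear_independent_extend[OF indep, of "\<lambda>b. f (inv_into A \<iota> b)"] by blast
    have eq: "g (\<iota> x) = f x" if "x \<in> A" for x
      using that g inj by simp
    have "g ` \<iota> ` A \<subseteq> topspace S"
      using S(2) eq by auto
    then show ?thesis
      using linear_continuous_direct_sum_topology[OF indep S(1) g(1)] g(1) eq by blast
  qed
  ultimately show ?thesis
    using locally_convex_direct_sum_topology[OF indep] indep
    by (simp add: free_locally_convex_space_def)
qed

end

theory Submission
  imports Defs
begin

text \<open>The free Abelian group on \<open>X\<close> with the discrete topology is an admissible target, and the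
  extension of the inclusion to \<open>A(X)\<close> is injective because it has a left inverse; so the identity of
  \<open>A(X)\<close> is isolated.

  If a base \<open>B\<close> at zero in \<open>L(X)\<close> had cardinality at most \<open>|X|\<close>, it could be listed as \<open>U\<^sub>x\<close> for
  \<open>x \<in> X\<close>, with \<open>e\<^sub>x x \<in> U\<^sub>x\<close> for some \<open>e\<^sub>x > 0\<close>. The linear map that scales each \<open>x\<close> by \<open>2 / e\<^sub>x\<close> is
  continuous into the direct sum topology, and the preimage of the unit ball of the \<open>\<ell>\<^sub>1\<close>-norm misses
  every \<open>e\<^sub>x x\<close>, hence contains no \<open>U\<^sub>x\<close>. A local \<open>\<omega>\<^sup>\<omega>\<close>-base has at most continuum many members.\<close>

section \<open>Local bases and their cardinality\<close>

lemma neighbourhoods_openin: "openin T W \<Longrightarrow> x \<in> W \<Longrightarrow> W \<in> neighbourhoods T x"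
  using openin_subset by (fastforce simp: neighbourhoods_def)

lemma local_base_nonempty:
  assumes "local_base T x B" "x \<in> topspace T"
  shows "B \<noteq> {}"
proof -
  have "topspace T \<in> neighbourhoods T x"
    using assms(2) by (intro neighbourhoods_openin) auto
  then show ?thesis
    using assms(1) by (auto simp: local_base_def)
qed

lemma has_local_omega_omega_base_discrete_topology:
  assumes "x \<in> S"
  shows "has_local_omega_omega_base (discrete_topology S) x"
proof -
  have "{x} \<in> neighbourhoods (discrete_topology S) x"
    using assms by (intro neighbourhoods_openin) auto
  moreover have "x \<in> N" if "N \<in> neighbourhoods (discrete_topology S) x" for N
    using that by (auto simp: neighbourhoods_def)
  ultimately show ?thesis
    unfolding has_local_omega_omega_base_def by (intro exI[of _ "\<lambda>_. {x}"]) auto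
qed

text \<open>A function is determined by its graph; pairing codes the graph as a set of naturals, and
  there are continuum many of those.\<close>

lemma card_nat_functions_le_continuum: "|UNIV :: (nat \<Rightarrow> nat) set| \<le>o continuum"
proof -
  define graph :: "(nat \<Rightarrow> nat) \<Rightarrow> nat set" where "graph f = range (\<lambda>n. prod_encode (n, f n))" for f
  have "f n = g n" if "graph f = graph g" for f g n
  proof -
    have "prod_encode (n, f n) \<in> graph g"
      using that by (auto simp: graph_def)
    then show ?thesis
      by (auto simp: graph_def)
  qed
  then have "inj graph"
    by (intro injI ext) blast
  then have "|UNIV :: (nat \<Rightarrow> nat) set| \<le>o |UNIV :: nat set set|"
    using card_of_ordLeq by blast
  also have "|UNIV :: nat set set| \<le>o continuum"
    using nat_sets_eqpoll_reals by (simp add: eqpoll_iff_card_of_ordIso ordIso_imp_ordLeq)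
  finally show ?thesis .
qed

lemma character_at_le_continuum:
  assumes "has_local_omega_omega_base T x"
  shows "character_at T x \<le>o continuum"
proof -
  obtain U :: "(nat \<Rightarrow> nat) \<Rightarrow> _" where
    "\<forall>\<alpha>. U \<alpha> \<in> neighbourhoods T x" "\<forall>N \<in> neighbourhoods T x. \<exists>\<alpha>. U \<alpha> \<subseteq> N"
    using assms by (auto simp: has_local_omega_omega_base_def)
  then have "local_base T x (range U)"
    by (auto simp: local_base_def)
  then have "character_at T x \<le>o |range U|"
    using character_at[of T x] by metis
  also have "|range U| \<le>o |UNIV :: (nat \<Rightarrow> nat) set|"
    by (rule card_of_image)
  also have "|UNIV :: (nat \<Rightarrow> nat) set| \<le>o continuum"
    by (rule card_nat_functions_le_continuum)
  finally show ?thesis .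
qed

section \<open>Free Abelian topological groups over discrete spaces\<close>

text \<open>Translation by the inverse of \<open>a\<close> is continuous and pulls the open set
  containing only the identity back to \<open>{a}\<close>.\<close>

lemma discrete_topological_abelian_group:
  assumes "topological_abelian_group G T" "openin T {\<one>\<^bsub>G\<^esub>}"
  shows "T = discrete_topology (carrier G)"
proof -
  interpret G: comm_group G
    using assms(1) by (simp add: topological_abelian_group_def)
  have top: "topspace T = carrier G"
    and mult: "continuous_map (prod_topology T T) T (\<lambda>(x, y). x \<otimes>\<^bsub>G\<^esub> y)"
    using assms(1) by (auto simp: topological_abelian_group_def)
  have "openin T {a}" if a: "a \<in> carrier G" for a
  proof -
    have "continuous_map T T (\<lambda>y. inv\<^bsub>G\<^esub> a \<otimes>\<^bsub>G\<^esub> y)"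
      using continuous_map_compose[of T "prod_topology T T" "\<lambda>y. (inv\<^bsub>G\<^esub> a, y)" T
          "\<lambda>(x, y). x \<otimes>\<^bsub>G\<^esub> y"] mult a top
      by (simp add: o_def continuous_map_pairedI)
    then have "openin T {y \<in> topspace T. inv\<^bsub>G\<^esub> a \<otimes>\<^bsub>G\<^esub> y \<in> {\<one>\<^bsub>G\<^esub>}}"
      using assms(2) by (rule openin_continuous_map_preimage)
    moreover have "{y \<in> topspace T. inv\<^bsub>G\<^esub> a \<otimes>\<^bsub>G\<^esub> y \<in> {\<one>\<^bsub>G\<^esub>}} = {a}"
      using a top G.inv_solve_left'[of "\<one>\<^bsub>G\<^esub>" a] by auto
    ultimately show ?thesis by simp
  qed
  then show ?thesis
    using discrete_topology_unique[of "carrier G" T] top by auto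
qed

text \<open>Serves to recognise a composite \<open>h \<circ> g\<close> as the identity by looking at
  generators only.\<close>

lemma hom_eq_on_generate:
  assumes "group G" "h \<in> hom G G" "S \<subseteq> carrier G" "\<And>x. x \<in> S \<Longrightarrow> h x = x"
    and "y \<in> generate G S"
  shows "h y = y"
proof -
  interpret h: group_hom G G h
    using assms(1,2) by (simp add: group_hom_def group_hom_axioms_def)
  show ?thesis
    using assms(5)
  proof (induction rule: generate.induct)
    case (eng a b)
    then show ?case
      using h.G.generate_in_carrier[OF assms(3)] by simp
  qed (use assms(3,4) in auto)
qed

lemma free_abelian_topological_group_discrete:
  fixes A :: "'a set" and G :: "'g monoid"
  assumes "free_abelian_topological_group TYPE('a \<Rightarrow>\<^sub>0 int) (discrete_topology A) G T \<iota>"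
  shows "T = discrete_topology (carrier G)"
proof -
  let ?F = "free_Abelian_group A"
  let ?D = "discrete_topology (carrier ?F)"
  have tG: "topological_abelian_group G T" and emb: "embedding_map (discrete_topology A) T \<iota>"
    and gen: "generate G (\<iota> ` A) = carrier G"
    and ext: "\<And>(H :: ('a \<Rightarrow>\<^sub>0 int) monoid) S f. topological_abelian_group H S \<Longrightarrow>
      continuous_map (discrete_topology A) S f \<Longrightarrow>
      \<exists>g \<in> hom G H. continuous_map T S g \<and> (\<forall>x \<in> A. g (\<iota> x) = f x)"
    using assms unfolding free_abelian_topological_group_def topspace_discrete_topology by blast+
  interpret G: comm_group G
    using tG by (simp add: topological_abelian_group_def)
  have top: "topspace T = carrier G"
    using tG by (simp add: topological_abelian_group_def)
  have \<iota>: "\<iota> ` A \<subseteq> carrier G"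
    using homeomorphic_imp_surjective_map[OF emb[unfolded embedding_map_def]]
    unfolding topspace_subtopology topspace_discrete_topology top by blast
  have tF: "topological_abelian_group ?F ?D"
    using free_abelian_topological_group_exists[where A = A]
    unfolding free_abelian_topological_group_def by blast
  have "continuous_map (discrete_topology A) ?D frag_of"
    by auto
  from ext[OF tF this] obtain g where g: "g \<in> hom G ?F" "continuous_map T ?D g"
    "\<And>x. x \<in> A \<Longrightarrow> g (\<iota> x) = frag_of x"
    by blast
  \<comment> \<open>This map comes from the algebraic universal property of \<open>?F\<close>; its
    sole purpose is to make \<open>g\<close> injective.\<close>
  obtain h where h: "h \<in> hom ?F G" "\<And>x. x \<in> A \<Longrightarrow> h (frag_of x) = \<iota> x"
    using G.free_Abelian_group_universal[OF \<iota>] by blast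
  interpret g: group_hom G ?F g
    using g(1) by (simp add: group_hom_def group_hom_axioms_def)
  have left_inverse: "h (g y) = y" if "y \<in> carrier G" for y
  proof -
    have "h \<circ> g \<in> hom G G"
      using hom_compose[OF g(1) h(1)] .
    moreover have "(h \<circ> g) z = z" if "z \<in> \<iota> ` A" for z
      using that g(3) h(2) by auto
    ultimately show ?thesis
      using hom_eq_on_generate[OF G.is_group _ \<iota>, of "h \<circ> g"] that gen by simp
  qed
  \<comment> \<open>This set is the kernel of \<open>g\<close>: open because the target is discrete,
    and trivial because \<open>h\<close> undoes \<open>g\<close>.\<close>
  have "openin T {y \<in> topspace T. g y \<in> {\<one>\<^bsub>?F\<^esub>}}"
    using g(2) by (rule openin_continuous_map_preimage) simp
  moreover have "{y \<in> topspace T. g y \<in> {\<one>\<^bsub>?F\<^esub>}} = {\<one>\<^bsub>G\<^esub>}"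
  proof (intro equalityI subsetI)
    fix y assume "y \<in> {y \<in> topspace T. g y \<in> {\<one>\<^bsub>?F\<^esub>}}"
    then have "y = h \<one>\<^bsub>?F\<^esub>"
      using left_inverse[of y] top by simp
    also have "\<dots> = \<one>\<^bsub>G\<^esub>"
      using left_inverse[OF G.one_closed] g.hom_one by simp
    finally show "y \<in> {\<one>\<^bsub>G\<^esub>}" by simp
  qed (use g.hom_one top in simp)
  ultimately show ?thesis
    by (intro discrete_topological_abelian_group[OF tG]) simp
qed

section \<open>Free locally convex spaces over discrete spaces\<close>

text \<open>The map sending \<open>c\<close> to \<open>c *\<^sub>R v\<close> is continuous and takes
  0 to 0, so all small scalars land in \<open>N\<close>.\<close>

lemma neighbourhood_absorbs:
  assumes T: "topological_vector_space T" and v: "v \<in> topspace T"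
    and N: "N \<in> neighbourhoods T 0"
  obtains e where "0 < e" "e *\<^sub>R v \<in> N"
proof -
  obtain W where W: "openin T W" "0 \<in> W" "W \<subseteq> N"
    using N by (auto simp: neighbourhoods_def)
  have "continuous_map euclideanreal T (\<lambda>c. c *\<^sub>R v)"
    using continuous_map_compose[of euclideanreal "prod_topology euclideanreal T"
        "\<lambda>c. (c, v)" T "\<lambda>(c, x). c *\<^sub>R x"] T v
    by (simp add: o_def continuous_map_pairedI topological_vector_space_def)
  then have "openin euclideanreal {c \<in> topspace euclideanreal. c *\<^sub>R v \<in> W}"
    using W(1) by (rule openin_continuous_map_preimage)
  then have "open {c. c *\<^sub>R v \<in> W}" by simp
  moreover have "0 \<in> {c. c *\<^sub>R v \<in> W}" using W(2) by simp
  \<comment> \<open>With a closed ball, the radius \<open>e\<close> is itself an admissible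
    scalar.\<close>
  ultimately obtain e where "e > 0" "cball 0 e \<subseteq> {c. c *\<^sub>R v \<in> W}"
    by (meson open_contains_cball)
  then have "e *\<^sub>R v \<in> N"
    using W(3) by (auto simp: subset_iff)
  then show thesis
    using that \<open>e > 0\<close> by blast
qed

lemma wnorm_basis:
  assumes "independent B" "b \<in> B"
  shows "wnorm B w b = w b"
  using assms by (subst wnorm_superset[of B "{b}"]) (auto simp: representation_basis split: if_splits)

text \<open>A diagonal argument: one neighbourhood \<open>N\<close> defeats every \<open>U x\<close>
  at once, each at its own point \<open>e x *\<^sub>R \<iota> x\<close>.\<close>

lemma local_base_free_locally_convex_space_discrete:
  fixes A :: "'a set" and T :: "'v::real_vector topology"
  assumes free: "free_locally_convex_space TYPE('v) (discrete_topology A) T \<iota>"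
    and base: "local_base T 0 B"
  shows "|A| <o |B|"
proof (rule ccontr)
  assume "\<not> |A| <o |B|"
  then have le: "|B| \<le>o |A|"
    by (simp add: not_ordLess_iff_ordLeq)
  \<comment> \<open>This target lies in the same type \<open>'v\<close> as \<open>T\<close>, so the
    assumed instance of the universal property applies to it.\<close>
  let ?S = "direct_sum_topology (\<iota> ` A)"
  have tvs: "topological_vector_space T" and indep: "independent (\<iota> ` A)"
    and span: "span (\<iota> ` A) = topspace T"
    and ext: "\<And>(S :: 'v topology) f. locally_convex_space S \<Longrightarrow>
      continuous_map (discrete_topology A) S f \<Longrightarrow>
      \<exists>g. linear g \<and> continuous_map T S g \<and> (\<forall>x \<in> A. g (\<iota> x) = f x)"
    using free unfolding free_locally_convex_space_def locally_convex_space_def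
      topspace_discrete_topology by blast+
  \<comment> \<open>A cardinal inequality yields a surjection from \<open>A\<close> onto
    \<open>B\<close> only when \<open>B\<close> is nonempty.\<close>
  have "B \<noteq> {}"
    using local_base_nonempty[OF base] span span_zero by metis
  with le obtain U where U: "U ` A = B"
    using card_of_ordLeq2 by metis
  have "\<exists>e>0. e *\<^sub>R \<iota> x \<in> U x" if "x \<in> A" for x
  proof -
    have "\<iota> x \<in> topspace T" "U x \<in> neighbourhoods T 0"
      using that U base span span_base[of "\<iota> x" "\<iota> ` A"] by (auto simp: local_base_def)
    then show ?thesis
      by (metis neighbourhood_absorbs[OF tvs])
  qed
  then obtain e where e: "\<And>x. x \<in> A \<Longrightarrow> 0 < e x" "\<And>x. x \<in> A \<Longrightarrow> e x *\<^sub>R \<iota> x \<in> U x"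
    by metis
  \<comment> \<open>The factor moves \<open>e x *\<^sub>R \<iota> x\<close> to a vector of norm 2.
    Any constant at least 1 would serve for 2, as the ball is given by a strict inequality.\<close>
  have "continuous_map (discrete_topology A) ?S (\<lambda>x. (2 / e x) *\<^sub>R \<iota> x)"
    using indep by (simp add: Pi_iff span_scale span_base)
  from ext[OF locally_convex_direct_sum_topology[OF indep] this]
  obtain g where g: "linear g" "continuous_map T ?S g"
    "\<And>x. x \<in> A \<Longrightarrow> g (\<iota> x) = (2 / e x) *\<^sub>R \<iota> x"
    by blast
  define N where "N = {y \<in> topspace T. g y \<in> wball (\<iota> ` A) (\<lambda>_. 1) 0}"
  have "openin T N"
    unfolding N_def using g(2)
    by (rule openin_continuous_map_preimage) (simp add: openin_wball[OF indep] span_zero)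
  moreover have "0 \<in> N"
    using g(1) span[symmetric] by (simp add: N_def linear_0 centre_in_wball[OF indep] span_zero)
  ultimately have "N \<in> neighbourhoods T 0"
    by (rule neighbourhoods_openin)
  then obtain x where x: "x \<in> A" "U x \<subseteq> N"
    using base U by (auto simp: local_base_def)
  then have "g (e x *\<^sub>R \<iota> x) \<in> wball (\<iota> ` A) (\<lambda>_. 1) 0"
    using e(2) by (auto simp: N_def)
  moreover have "g (e x *\<^sub>R \<iota> x) = 2 *\<^sub>R \<iota> x"
    using e(1)[OF x(1)] g x by (simp add: linear_scale)
  moreover have "wnorm (\<iota> ` A) (\<lambda>_. 1) (2 *\<^sub>R \<iota> x) = 2"
    using x(1) by (simp add: wnorm_scale[OF indep] wnorm_basis[OF indep] span_base)
  ultimately show False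
    by (simp add: wball_def[OF indep])
qed

theorem mainTheorem8:
  fixes X :: "'a topology"
    and G :: "'g monoid" and T_A :: "'g topology" and \<iota>_A :: "'a \<Rightarrow> 'g"
    and T_L :: "'v::real_vector topology" and \<iota>_L :: "'a \<Rightarrow> 'v"
  assumes discrete: "X = discrete_topology (topspace X)"
    and card: "continuum \<le>o |topspace X|"
    and free_group: "free_abelian_topological_group TYPE('a \<Rightarrow>\<^sub>0 int) X G T_A \<iota>_A"
    and free_lcs: "free_locally_convex_space TYPE('v) X T_L \<iota>_L"
  shows "T_A = discrete_topology (carrier G) \<and>
    has_local_omega_omega_base T_A \<one>\<^bsub>G\<^esub> \<and>
    cardSuc continuum \<le>o character_at T_L 0 \<and>
    \<not> has_local_omega_omega_base T_L 0"
proof -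
  have T_A: "T_A = discrete_topology (carrier G)"
    by (rule free_abelian_topological_group_discrete[of "topspace X" _ _ \<iota>_A])
      (use free_group in \<open>unfold discrete[symmetric]\<close>)
  have "monoid G"
    using free_group
    by (simp add: free_abelian_topological_group_def topological_abelian_group_def
        comm_group_def group_def)
  then have omega_A: "has_local_omega_omega_base T_A \<one>\<^bsub>G\<^esub>"
    unfolding T_A by (intro has_local_omega_omega_base_discrete_topology monoid.one_closed)
  \<comment> \<open>The character is attained by an actual base, so the strict bound on bases passes
    to it; strictness is what yields the successor cardinal.\<close>
  obtain B where B: "local_base T_L 0 B" "character_at T_L 0 = |B|"
    by (rule character_at)
  have "|topspace X| <o |B|"
    by (rule local_base_free_locally_convex_space_discrete[of _ _ \<iota>_L, OF _ B(1)])
      (use free_lcs in \<open>unfold discrete[symmetric]\<close>)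
  then have less: "continuum <o character_at T_L 0"
    unfolding B(2) using card by (rule ordLeq_ordLess_trans[rotated])
  then have "cardSuc continuum \<le>o character_at T_L 0"
    unfolding B(2) by (intro cardSuc_least card_of_Card_order)
  moreover have "\<not> has_local_omega_omega_base T_L 0"
    using not_ordLess_ordLeq[OF less] character_at_le_continuum[of T_L 0] by iprover
  ultimately show ?thesis
    using T_A omega_A by blast
qed

end
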